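(* Let $\vec\mu=\mu_1\times\mu_2$ and $\vec\nu=\nu_1\times\nu_2$ be positive measures on the space $X\times X$ and, for $i\in\{1,2\}$, let $K_i$ be a nonnegative function on $X\times X$. Let $T$ be the integral operator defined by, for any $(x,y)\in X\times X$, $$Tf(x,y):=\int_X\int_X K_1(x,s)K_2(y,t)f(s,t)\,d\mu_1(s)\,d\mu_2(t).$$ Suppose $\vec p=(p_1,1)$ with $p_1\in(1,\infty)$ and $\vec q=(q_1,q_2)\in(1,\infty)^2$ satisfy $1<p_1\le q_-<\infty$, where $q_-:=\min\{q_1,q_2\}$. Let $\gamma_i,\delta_i$ be real numbers with $\gamma_i+\delta_i=1$ for $i\in\{1,2\}$. If there exist two positive functions $h_1,h_2$ on $X\times X$ and two positive constants $C_1,C_2$ such that for almost all $(x,y)\in X\times X$, $$\operatorname*{ess\,sup}_{t\in X}\int_X [K_1(x,s)]^{\gamma_1p_1'}[K_2(y,t)]^{\gamma_2p_1'}[h_1(s,t)]^{p_1'}\,d\mu_1(s)\le C_1[h_2(x,y)]^{p_1'}$$ and for almost all $(s,t)\in X\times X$, $$\int_X\Big[\int_X [K_1(x,s)]^{\delta_1q_1}[K_2(y,t)]^{\delta_2q_1}[h_2(x,y)]^{q_1}\,d\nu_1(x)\Big]^{q_2/q_1}d\nu_2(y)\le C_2[h_1(s,t)]^{q_2},$$ then $T:L^{\vec p}_{\vec\mu}\to L^{\vec q}_{\vec\nu}$ is bounded with $\|T\|_{L^{\vec p}_{\vec\mu}\to L^{\vec q}_{\vec\nu}}\le C_1^{1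/p_1'}C_2^{1/q_2}$.
   Context: For $q\in[1,\infty]$, $q'$ is the Hölder conjugate exponent, $1/q+1/q'=1$. For $\vec p=(p_1,p_2)\in[1,\infty)^2$ and a product measure $\vec\mu=\mu_1\times\mu_2$ on $X\times X$, $L^{\vec p}_{\vec\mu}$ is the mixed-norm Lebesgue space of measurable $f$ on $X\times X$ with $$\|f\|_{L^{\vec p}_{\vec\mu}}=\Big\{\int_X\Big[\int_X|f(s,t)|^{p_1}\,d\mu_1(s)\Big]^{p_2/p_1}d\mu_2(t)\Big\}^{1/p_2}<\infty.$$ *)

theory Defs
  imports "HOL-Probability.Essential_Supremum"
begin

text \<open>
  Real powers on \<open>[0, \<infinity>]\<close> with the measure-theoretic conventions: for \<open>a > 0\<close>, \<open>0\<^sup>a = 0\<close> and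
  \<open>\<infinity>\<^sup>a = \<infinity>\<close>; for \<open>a < 0\<close>, \<open>0\<^sup>a = \<infinity>\<close> and \<open>\<infinity>\<^sup>a = 0\<close>; and \<open>x\<^sup>0 = 1\<close> for all \<open>x\<close>.
  (The library's \<^const>\<open>powr\<close> has \<open>0 powr a = 0\<close> for every \<open>a\<close>, also for \<open>a \<le> 0\<close>.)
\<close>
definition epowr :: "ennreal \<Rightarrow> real \<Rightarrow> ennreal"  (infixr "epowr" 80) where
  "x epowr a =
     (if a = 0 then 1
      else if a > 0 then (if x = \<infinity> then \<infinity> else ennreal (enn2real x powr a))
      else (if x = 0 then \<infinity> else if x = \<infinity> then 0 else ennreal (enn2real x powr a)))"

definition mixed_norm ::
  "'a measure \<Rightarrow> 'a measure \<Rightarrow> real \<Rightarrow> real \<Rightarrow> ('a \<times> 'a \<Rightarrow> complex) \<Rightarrow> ennreal" where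
  "mixed_norm \<mu>1 \<mu>2 p1 p2 f =
     (\<integral>\<^sup>+ t. (\<integral>\<^sup>+ s. ennreal (cmod (f (s, t))) epowr p1 \<partial>\<mu>1) epowr (p2 / p1) \<partial>\<mu>2) epowr (1 / p2)"

text \<open>Functions are not identified almost everywhere here, so \<^term>\<open>mixed_norm\<close> is a seminorm.\<close>
definition mixed_Lp ::
  "'a measure \<Rightarrow> 'a measure \<Rightarrow> real \<Rightarrow> real \<Rightarrow> ('a \<times> 'a \<Rightarrow> complex) set" where
  "mixed_Lp \<mu>1 \<mu>2 p1 p2 =
     {f \<in> borel_measurable (\<mu>1 \<Otimes>\<^sub>M \<mu>2). mixed_norm \<mu>1 \<mu>2 p1 p2 f < \<infinity>}"

text \<open>
  The Bochner integrals below are \<open>0\<close> where the integrand is not integrable; that the kernel is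
  absolutely integrable against \<open>f\<close> for almost all \<open>(x, y)\<close> is the separate property
  \<open>kernel_op_defined\<close>.
\<close>
definition kernel_op ::
  "'a measure \<Rightarrow> 'a measure \<Rightarrow> ('a \<times> 'a \<Rightarrow> real) \<Rightarrow> ('a \<times> 'a \<Rightarrow> real)
     \<Rightarrow> ('a \<times> 'a \<Rightarrow> complex) \<Rightarrow> 'a \<times> 'a \<Rightarrow> complex" where
  "kernel_op \<mu>1 \<mu>2 K1 K2 f =
     (\<lambda>(x, y). LINT t|\<mu>2. LINT s|\<mu>1. complex_of_real (K1 (x, s) * K2 (y, t)) * f (s, t))"

definition kernel_op_defined ::
  "'a measure \<Rightarrow> 'a measure \<Rightarrow> 'a measure \<Rightarrow> 'a measure
     \<Rightarrow> ('a \<times> 'a \<Rightarrow> real) \<Rightarrow> ('a \<times> 'a \<Rightarrow> real) \<Rightarrow> ('a \<times> 'a \<Rightarrow> complex) \<Rightarrow> bool" where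
  "kernel_op_defined \<mu>1 \<mu>2 \<nu>1 \<nu>2 K1 K2 f \<longleftrightarrow>
     (AE (x, y) in \<nu>1 \<Otimes>\<^sub>M \<nu>2.
        integrable (\<mu>1 \<Otimes>\<^sub>M \<mu>2) (\<lambda>(s, t). complex_of_real (K1 (x, s) * K2 (y, t)) * f (s, t)))"

text \<open>
  A bounded linear operator between mixed-norm spaces, acting on representatives: linearity is
  required up to null sets. Linearity and the norm bound together make the operator
  compatible with almost-everywhere equality.
\<close>
definition mixed_bounded_op ::
  "'a measure \<Rightarrow> 'a measure \<Rightarrow> real \<Rightarrow> real \<Rightarrow> 'a measure \<Rightarrow> 'a measure \<Rightarrow> real \<Rightarrow> real
     \<Rightarrow> (('a \<times> 'a \<Rightarrow> complex) \<Rightarrow> 'a \<times> 'a \<Rightarrow> complex) \<Rightarrow> bool" where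
  "mixed_bounded_op \<mu>1 \<mu>2 p1 p2 \<nu>1 \<nu>2 q1 q2 T \<longleftrightarrow>
     (\<forall>f \<in> mixed_Lp \<mu>1 \<mu>2 p1 p2. T f \<in> mixed_Lp \<nu>1 \<nu>2 q1 q2) \<and>
     (\<forall>f \<in> mixed_Lp \<mu>1 \<mu>2 p1 p2. \<forall>g \<in> mixed_Lp \<mu>1 \<mu>2 p1 p2. \<forall>a b.
        AE z in \<nu>1 \<Otimes>\<^sub>M \<nu>2. T (\<lambda>w. a * f w + b * g w) z = a * T f z + b * T g z) \<and>
     (\<exists>C::real. \<forall>f \<in> mixed_Lp \<mu>1 \<mu>2 p1 p2.
        mixed_norm \<nu>1 \<nu>2 q1 q2 (T f) \<le> ennreal C * mixed_norm \<mu>1 \<mu>2 p1 p2 f)"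

definition mixed_op_norm ::
  "'a measure \<Rightarrow> 'a measure \<Rightarrow> real \<Rightarrow> real \<Rightarrow> 'a measure \<Rightarrow> 'a measure \<Rightarrow> real \<Rightarrow> real
     \<Rightarrow> (('a \<times> 'a \<Rightarrow> complex) \<Rightarrow> 'a \<times> 'a \<Rightarrow> complex) \<Rightarrow> ennreal" where
  "mixed_op_norm \<mu>1 \<mu>2 p1 p2 \<nu>1 \<nu>2 q1 q2 T =
     (SUP f \<in> {f \<in> mixed_Lp \<mu>1 \<mu>2 p1 p2. mixed_norm \<mu>1 \<mu>2 p1 p2 f \<le> 1}.
        mixed_norm \<nu>1 \<nu>2 q1 q2 (T f))"

end

theory Submission
  imports Defs
begin

text \<open>
  Schur's test for mixed norms. Split the kernel as
  \<open>K\<^sub>1 K\<^sub>2 \<le> (K\<^sub>1\<^bsup>\<gamma>\<^sub>1\<^esup> K\<^sub>2\<^bsup>\<gamma>\<^sub>2\<^esup> h\<^sub>1) \<cdot> (K\<^sub>1\<^bsup>\<delta>\<^sub>1\<^esup> K\<^sub>2\<^bsup>\<delta>\<^sub>2\<^esup> / h\<^sub>1)\<close> and apply Hoelder's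
  inequality in \<open>s\<close> for each \<open>t\<close>; the first hypothesis bounds one factor by a multiple of
  \<open>h\<^sub>2 (x, y)\<close>. What remains is the mixed norm in \<open>(x, y)\<close> of an integral over \<open>t\<close> of an
  \<open>L\<^sup>p\<close> norm in \<open>s\<close>. Minkowski's integral inequality pulls the integral over \<open>t\<close> out of
  the mixed norm with exponents \<open>q\<^sub>1, q\<^sub>2\<close>, and then, because \<open>q\<^sub>1 / p\<^sub>1 \<ge> 1\<close> and
  \<open>q\<^sub>2 / p\<^sub>1 \<ge> 1\<close>, the integral over \<open>s\<close> out of the mixed norm with these exponents. The second
  hypothesis then bounds the integrand.
\<close>

subsection \<open>Real powers of extended nonnegative numbers\<close>

lemma epowr_pos: "a > 0 \<Longrightarrow> x epowr a = (if x = \<infinity> then \<infinity> else ennreal (enn2real x powr a))"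
  by (simp add: epowr_def)

lemma epowr_0_left [simp]: "a > 0 \<Longrightarrow> 0 epowr a = 0"
  by (simp add: epowr_pos)

lemma epowr_top_left [simp]: "a > 0 \<Longrightarrow> top epowr a = top"
  by (simp add: epowr_pos)

lemma epowr_ennreal: "r \<ge> 0 \<Longrightarrow> a > 0 \<Longrightarrow> ennreal r epowr a = ennreal (r powr a)"
  by (simp add: epowr_pos)

lemma epowr_ennreal_pos: "r > 0 \<Longrightarrow> ennreal r epowr a = ennreal (r powr a)"
  by (simp add: epowr_def)

lemma epowr_one [simp]: "x epowr 1 = x"
  by (cases x) (auto simp: epowr_pos)

lemma epowr_mult: "a > 0 \<Longrightarrow> (x * y) epowr a = x epowr a * y epowr a"
  by (cases x; cases y)
     (auto simp: epowr_pos ennreal_mult[symmetric] powr_mult ennreal_mult_top ennreal_top_mult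
        ennreal_mult_eq_top_iff)

text \<open>Only the outer exponent has to be positive. The inner one may have any sign, as the
  exponents \<open>\<gamma>1\<close>, \<open>\<gamma>2\<close>, \<open>\<delta>1\<close>,
  \<open>\<delta>2\<close> of the kernels do.\<close>

lemma epowr_epowr: "b > 0 \<Longrightarrow> (x epowr a) epowr b = x epowr (a * b)"
  by (cases x) (auto simp: epowr_def powr_powr mult_less_0_iff zero_less_mult_iff)

lemma epowr_add: "a > 0 \<Longrightarrow> b > 0 \<Longrightarrow> x epowr (a + b) = x epowr a * x epowr b"
  by (cases x) (auto simp: epowr_pos ennreal_mult[symmetric] powr_add)

lemma epowr_mono: "a > 0 \<Longrightarrow> x \<le> y \<Longrightarrow> x epowr a \<le> y epowr a"
  by (cases x; cases y) (auto simp: epowr_pos powr_mono2 top_unique)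

text \<open>The powers \<open>a\<close> and \<open>1 / a\<close> are mutually inverse monotone maps
  of [0, \<infinity>], so they form a Galois connection; roots can be moved across an inequality
  without finiteness conditions.\<close>

lemma epowr_le_iff: "a > 0 \<Longrightarrow> x epowr a \<le> y \<longleftrightarrow> x \<le> y epowr (1 / a)"
  using epowr_mono[of a x "y epowr (1/a)"] epowr_mono[of "1/a" "x epowr a" y]
  by (auto simp: epowr_epowr)

lemma epowr_eq_top_iff: "a > 0 \<Longrightarrow> x epowr a = top \<longleftrightarrow> x = top"
  by (cases x) (auto simp: epowr_pos)

lemma epowr_eq_0_iff: "a > 0 \<Longrightarrow> x epowr a = 0 \<longleftrightarrow> x = 0"
  by (cases x) (auto simp: epowr_pos)

text \<open>A lower adjoint of a Galois connection preserves all suprema, so no continuity argument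
  is required.\<close>

lemma epowr_SUP:
  assumes "a > 0" shows "(SUP i\<in>I. f i) epowr a = (SUP i\<in>I. f i epowr a)"
proof (rule antisym)
  show "(SUP i\<in>I. f i) epowr a \<le> (SUP i\<in>I. f i epowr a)"
    unfolding epowr_le_iff[OF assms]
  proof (rule SUP_least)
    fix i assume "i \<in> I"
    then show "f i \<le> (SUP i\<in>I. f i epowr a) epowr (1 / a)"
      unfolding epowr_le_iff[OF assms, symmetric] by (rule SUP_upper)
  qed
  show "(SUP i\<in>I. f i epowr a) \<le> (SUP i\<in>I. f i) epowr a"
    by (intro SUP_least epowr_mono assms SUP_upper)
qed

lemma borel_measurable_epowr [measurable (raw)]:
  assumes [measurable]: "f \<in> borel_measurable M"
  shows "(\<lambda>x. f x epowr a) \<in> borel_measurable M"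
  unfolding epowr_def by measurable

text \<open>For positive \<open>K\<close> and \<open>L\<close> the exponents add up to 1 and
  \<open>h\<close> cancels. If \<open>K\<close> or \<open>L\<close> is 0, the left side is 0,
  whatever value the convention gives to 0 raised to a negative power.\<close>

lemma ennreal_le_epowr_split:
  assumes "K \<ge> 0" "L \<ge> 0" "h > 0" "\<gamma>1 + \<delta>1 = 1" "\<gamma>2 + \<delta>2 = 1"
  shows "ennreal (K * L)
    \<le> (ennreal K epowr \<gamma>1 * ennreal L epowr \<gamma>2 * ennreal h)
      * (ennreal K epowr \<delta>1 * ennreal L epowr \<delta>2 * ennreal (inverse h))"
proof (cases "K = 0 \<or> L = 0")
  case False
  then have KL: "K > 0" "L > 0" using assms by auto
  have "K * L = K powr (\<gamma>1 + \<delta>1) * L powr (\<gamma>2 + \<delta>2)"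
    using assms KL by simp
  also have "\<dots> = (K powr \<gamma>1 * L powr \<gamma>2 * h) * (K powr \<delta>1 * L powr \<delta>2 * inverse h)"
    using assms(3) by (simp add: powr_add)
  finally show ?thesis
    using assms KL by (simp add: epowr_ennreal_pos flip: ennreal_mult)
qed auto

subsection \<open>Inequalities of Hoelder and Minkowski\<close>

lemma conjugate_exponent_gt_1:
  assumes "p > 1" "1 / p + 1 / p' = (1::real)" shows "p' > 1"
proof -
  have "0 < 1 / p" "1 / p < 1" using assms(1) by auto
  then have "0 < 1 / p'" "1 / p' < 1" using assms(2) by linarith+
  then show ?thesis by (simp add: zero_less_divide_iff divide_less_eq_1)
qed

text \<open>Both coefficients are positive, so an infinite argument makes the right side infinite;
  otherwise this is Young's inequality for real numbers.\<close>

lemma ennreal_Young: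
  assumes "p > 1" "1 / p + 1 / p' = (1::real)"
  shows "x * y \<le> ennreal (1 / p) * x epowr p + ennreal (1 / p') * y epowr p'"
proof -
  note q = conjugate_exponent_gt_1[OF assms]
  show ?thesis
  proof (cases "x = \<infinity> \<or> y = \<infinity>")
    case True
    then show ?thesis using assms q by (auto simp: ennreal_mult_eq_top_iff)
  next
    case False
    then obtain r s where rs: "x = ennreal r" "y = ennreal s" "r \<ge> 0" "s \<ge> 0"
      by (metis ennreal_cases infinity_ennreal_def)
    have "r * s \<le> (1 / p) * r powr p + (1 / p') * s powr p'"
      using Youngs_inequality[of p p' r s] rs assms q by simp
    then show ?thesis
      using rs assms q
      by (simp add: epowr_ennreal flip: ennreal_mult ennreal_plus)
  qed
qed

lemma nn_integral_Holder:
  assumes p: "p > 1" "1 / p + 1 / p' = (1::real)"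
    and [measurable]: "f \<in> borel_measurable M" "g \<in> borel_measurable M"
  shows "(\<integral>\<^sup>+x. f x * g x \<partial>M)
    \<le> (\<integral>\<^sup>+x. f x epowr p \<partial>M) epowr (1 / p) * (\<integral>\<^sup>+x. g x epowr p' \<partial>M) epowr (1 / p')"
    (is "?L \<le> ?A epowr _ * ?B epowr _")
proof -
  note q = conjugate_exponent_gt_1[OF p]
  consider "?A = 0 \<or> ?B = 0" | "?A \<noteq> 0" "?B \<noteq> 0" "?A = \<infinity> \<or> ?B = \<infinity>"
    | "?A \<noteq> 0" "?B \<noteq> 0" "?A \<noteq> \<infinity>" "?B \<noteq> \<infinity>" by blast
  then show ?thesis
  proof cases
    \<comment> \<open>One of the two functions vanishes almost everywhere, so the left side is 0
      even if the other integral is infinite.\<close>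
    case 1
    then have "(AE x in M. f x = 0) \<or> (AE x in M. g x = 0)"
      using p q by (auto simp: nn_integral_0_iff_AE epowr_eq_0_iff)
    then have "AE x in M. f x * g x = 0" by auto
    then have "?L = 0" by (simp add: nn_integral_0_iff_AE)
    then show ?thesis by simp
  next
    case 2
    then show ?thesis
      using p q epowr_eq_0_iff[of "1/p" ?A] epowr_eq_0_iff[of "1/p'" ?B]
      by (auto simp: ennreal_mult_eq_top_iff epowr_pos split: if_splits)
  next
    case 3
    \<comment> \<open>\<open>a\<close> and \<open>b\<close> are the norms of \<open>f\<close> and
      \<open>g\<close>. Dividing by them gives functions of norm 1, for which the integral of
      Young's inequality is at most \<open>1 / p + 1 / p' = 1\<close>; multiplying by
      \<open>a * b\<close> undoes the normalisation.\<close>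
    define a where "a = ?A epowr (1 / p)"
    define b where "b = ?B epowr (1 / p')"
    have a: "a \<noteq> 0" "a \<noteq> \<infinity>" "a epowr p = ?A" and b: "b \<noteq> 0" "b \<noteq> \<infinity>" "b epowr p' = ?B"
      using 3 p q by (auto simp: a_def b_def epowr_eq_0_iff epowr_eq_top_iff epowr_epowr)
    have inv: "inverse c * c = 1" if "c \<noteq> 0" "c \<noteq> \<infinity>" for c :: ennreal
      using that ennreal_divide_self[of c] by (simp add: divide_ennreal_def mult.commute less_top)
    have *: "(\<integral>\<^sup>+x. (inverse c * u x) epowr r \<partial>M) = 1"
      if "r > 0" "c \<noteq> 0" "c \<noteq> \<infinity>" "c epowr r = (\<integral>\<^sup>+x. u x epowr r \<partial>M)"
        "u \<in> borel_measurable M" for u c r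
    proof -
      have "(\<integral>\<^sup>+x. (inverse c * u x) epowr r \<partial>M) = inverse c epowr r * c epowr r"
        using that by (simp add: epowr_mult nn_integral_cmult)
      also have "\<dots> = (inverse c * c) epowr r"
        using that by (simp only: epowr_mult)
      also have "\<dots> = 1" using that inv[of c] by (simp add: epowr_def)
      finally show ?thesis .
    qed
    have "(\<integral>\<^sup>+x. (inverse a * f x) * (inverse b * g x) \<partial>M)
      \<le> (\<integral>\<^sup>+x. ennreal (1 / p) * (inverse a * f x) epowr p
              + ennreal (1 / p') * (inverse b * g x) epowr p' \<partial>M)"
      by (intro nn_integral_mono ennreal_Young p)
    also have "\<dots> = ennreal (1 / p) + ennreal (1 / p')"
      using p q a b by (simp add: nn_integral_add nn_integral_cmult *)
    also have "\<dots> = 1"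
      using p q by (simp flip: ennreal_plus)
    finally have "(\<integral>\<^sup>+x. (inverse a * inverse b) * (f x * g x) \<partial>M) \<le> 1"
      by (simp add: ac_simps)
    then have "(inverse a * inverse b) * ?L \<le> 1"
      by (simp add: nn_integral_cmult)
    then have "(a * b) * ((inverse a * inverse b) * ?L) \<le> (a * b) * 1"
      by (intro mult_left_mono) auto
    also have "(a * b) * ((inverse a * inverse b) * ?L) = (inverse a * a) * (inverse b * b) * ?L"
      by (simp add: ac_simps)
    finally show ?thesis
      using a b by (simp add: inv a_def b_def)
  qed
qed

text \<open>
  Write \<open>I = \<integral> u\<^sup>q\<close> and \<open>R\<close> for the right-hand side. Fubini and Hoelder give
  \<open>I \<le> I\<^bsup>1 - 1/q\<^esup> R\<close>, where the power of \<open>I\<close> can be cancelled since \<open>I\<close> is finite. The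
  minorant \<open>u\<close> of \<open>\<integral> G\<close> is there for the truncation that ensures finiteness.
\<close>

lemma nn_integral_Minkowski_aux:
  assumes "sigma_finite_measure M" "sigma_finite_measure N" and q: "q > 1"
    and G [measurable]: "(\<lambda>(x, w). G x w) \<in> borel_measurable (M \<Otimes>\<^sub>M N)"
    and [measurable]: "u \<in> borel_measurable M"
    and u: "\<And>x. x \<in> space M \<Longrightarrow> u x \<le> (\<integral>\<^sup>+w. G x w \<partial>N)"
    and fin: "(\<integral>\<^sup>+x. u x epowr q \<partial>M) < \<infinity>"
  shows "(\<integral>\<^sup>+x. u x epowr q \<partial>M) epowr (1 / q) \<le> (\<integral>\<^sup>+w. (\<integral>\<^sup>+x. G x w epowr q \<partial>M) epowr (1 / q) \<partial>N)"
    (is "?I epowr _ \<le> ?R")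
proof (cases "?I = 0")
  case True
  then show ?thesis using q by simp
next
  case False
  interpret M: sigma_finite_measure M by fact
  interpret N: sigma_finite_measure N by fact
  interpret pair_sigma_finite M N ..
  \<comment> \<open>The conjugate exponent of \<open>q\<close>: the factor
    \<open>u epowr (q - 1)\<close> raised to \<open>q'\<close> is \<open>u epowr q\<close> again,
    which makes the integral \<open>?I\<close> reappear on the right.\<close>
  define q' where "q' = q / (q - 1)"
  have qq: "1 / q' + 1 / q = 1" "q' > 1" using q by (auto simp: q'_def field_simps)
  have [simp]: "(q - 1) * q' = q" using q by (auto simp: q'_def)
  have "?I = (\<integral>\<^sup>+x. u x epowr (q - 1) * u x \<partial>M)"
    using epowr_add[of "q - 1" 1] q by simp
  also have "\<dots> \<le> (\<integral>\<^sup>+x. u x epowr (q - 1) * (\<integral>\<^sup>+w. G x w \<partial>N) \<partial>M)"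
    by (intro nn_integral_mono mult_left_mono u) auto
  also have "\<dots> = (\<integral>\<^sup>+x. \<integral>\<^sup>+w. u x epowr (q - 1) * G x w \<partial>N \<partial>M)"
    by (intro nn_integral_cong nn_integral_cmult[symmetric]) measurable
  also have "\<dots> = (\<integral>\<^sup>+w. \<integral>\<^sup>+x. u x epowr (q - 1) * G x w \<partial>M \<partial>N)"
    by (rule Fubini'[symmetric]) measurable
  also have "\<dots> \<le> (\<integral>\<^sup>+w. (\<integral>\<^sup>+x. (u x epowr (q - 1)) epowr q' \<partial>M) epowr (1 / q')
                        * (\<integral>\<^sup>+x. G x w epowr q \<partial>M) epowr (1 / q) \<partial>N)"
    using qq by (intro nn_integral_mono nn_integral_Holder) auto
  also have "\<dots> = ?I epowr (1 / q') * ?R"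
    using qq by (simp add: epowr_epowr nn_integral_cmult)
  finally have le: "?I \<le> ?I epowr (1 / q') * ?R" .
  have I: "?I = ?I epowr (1 / q') * ?I epowr (1 / q)"
    using epowr_add[of "1 / q'" "1 / q" ?I] qq q by simp
  have nz: "?I epowr (1 / q') \<noteq> 0" "?I epowr (1 / q') < top"
    using False fin qq epowr_eq_0_iff[of "1 / q'" ?I] epowr_eq_top_iff[of "1 / q'" ?I]
    by (auto simp: less_top)
  have "?I epowr (1 / q') * ?I epowr (1 / q) \<le> ?I epowr (1 / q') * ?R"
    using le I by simp
  then show ?thesis
    using nz by (simp add: ennreal_mult_le_mult_iff)
qed

text \<open>For \<open>q = 1\<close> this is Tonelli's theorem. For \<open>q > 1\<close> the
  auxiliary bound is applied to truncations of the inner integral, and monotone convergence removes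
  the truncation.\<close>

lemma nn_integral_Minkowski:
  assumes "sigma_finite_measure M" "sigma_finite_measure N" and q: "q \<ge> 1"
    and G [measurable]: "(\<lambda>(x, w). G x w) \<in> borel_measurable (M \<Otimes>\<^sub>M N)"
  shows "(\<integral>\<^sup>+x. (\<integral>\<^sup>+w. G x w \<partial>N) epowr q \<partial>M) epowr (1 / q)
    \<le> (\<integral>\<^sup>+w. (\<integral>\<^sup>+x. G x w epowr q \<partial>M) epowr (1 / q) \<partial>N)" (is "_ \<le> ?R")
proof -
  interpret M: sigma_finite_measure M by fact
  interpret N: sigma_finite_measure N by fact
  interpret pair_sigma_finite M N ..
  show ?thesis
  proof (cases "q = 1")
    case True
    then show ?thesis by (simp add: Fubini')
  next
    case False
    then have q1: "q > 1" using q by simp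
    obtain A :: "nat \<Rightarrow> _" where A: "range A \<subseteq> sets M" "(\<Union>i. A i) = space M"
      "\<And>i. emeasure M (A i) \<noteq> \<infinity>" "incseq A"
      using M.sigma_finite_incseq by blast
    have [measurable]: "A i \<in> sets M" for i using A by auto
    define H where "H x = (\<integral>\<^sup>+w. G x w \<partial>N)" for x
    have [measurable]: "H \<in> borel_measurable M" unfolding H_def by measurable
    \<comment> \<open>Cutting at height \<open>n\<close> and restricting to the set
      \<open>A n\<close> of finite measure makes the integral of the \<open>q\<close>-th power
      finite; both cuts disappear as \<open>n\<close> grows.\<close>
    define u where "u n x = min (H x) (of_nat n) * indicator (A n) x" for n x
    have [measurable]: "u n \<in> borel_measurable M" for n unfolding u_def by measurable
    have inc: "u m x \<le> u n x" if "m \<le> n" for m n x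
    proof -
      have "min (H x) (of_nat m) \<le> min (H x) (of_nat n)"
        using that by (intro min.mono) auto
      moreover have "indicator (A m) x \<le> (indicator (A n) x :: ennreal)"
        using incseqD[OF A(4) that] by (auto split: split_indicator)
      ultimately show ?thesis unfolding u_def by (rule mult_mono) auto
    qed
    have SUP: "(SUP n. u n x) = H x" if x: "x \<in> space M" for x
    proof -
      obtain k where k: "x \<in> A k" using x unfolding A(2)[symmetric] by blast
      show ?thesis
      proof (rule antisym)
        show "(SUP n. u n x) \<le> H x"
          by (intro SUP_least) (auto simp: u_def indicator_def)
        show "H x \<le> (SUP n. u n x)"
        proof -
          have "H x = (SUP n. min (H x) (of_nat n))"
            using inf_SUP[of "H x" of_nat "UNIV :: nat set"]
            by (simp only: ennreal_SUP_of_nat_eq_top inf_min) simp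
          also have "\<dots> \<le> (SUP n. u n x)"
          proof (intro SUP_mono)
            fix n :: nat
            \<comment> \<open>The index \<open>max k n\<close> serves both cuts: the point lies in
              the set, and the height is at least \<open>n\<close>.\<close>
            have "x \<in> A (max k n)" using k incseqD[OF A(4), of k "max k n"] by auto
            then have "min (H x) (of_nat n) \<le> u (max k n) x"
              by (simp add: u_def min.coboundedI2 of_nat_mono)
            then show "\<exists>m\<in>UNIV. min (H x) (of_nat n) \<le> u m x" by blast
          qed
          finally show ?thesis .
        qed
      qed
    qed
    have "(\<integral>\<^sup>+x. u n x epowr q \<partial>M) \<le> ?R epowr q" for n
    proof -
      have "(\<integral>\<^sup>+x. u n x epowr q \<partial>M) \<le> (\<integral>\<^sup>+x. of_nat n epowr q * indicator (A n) x \<partial>M)"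
        using q by (intro nn_integral_mono) (auto simp: u_def indicator_def intro!: epowr_mono)
      also have "\<dots> < \<infinity>"
        using A(3)[of n] q epowr_eq_top_iff[of q "of_nat n"]
        by (auto simp: nn_integral_cmult_indicator ennreal_mult_less_top less_top)
      finally have "(\<integral>\<^sup>+x. u n x epowr q \<partial>M) epowr (1 / q) \<le> ?R"
        by (intro nn_integral_Minkowski_aux assms q1)
           (auto simp: u_def H_def indicator_def)
      then show ?thesis using q by (simp add: epowr_le_iff)
    qed
    then have "(SUP n. \<integral>\<^sup>+x. u n x epowr q \<partial>M) \<le> ?R epowr q"
      by (rule SUP_least)
    also have "(SUP n. \<integral>\<^sup>+x. u n x epowr q \<partial>M) = (\<integral>\<^sup>+x. (SUP n. u n x epowr q) \<partial>M)"
      using q by (intro nn_integral_monotone_convergence_SUP[symmetric])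
         (auto simp: incseq_def le_fun_def intro!: epowr_mono inc)
    also have "\<dots> = (\<integral>\<^sup>+x. H x epowr q \<partial>M)"
      using q by (intro nn_integral_cong) (simp add: SUP flip: epowr_SUP)
    finally show ?thesis using q by (simp add: epowr_le_iff H_def)
  qed
qed

subsection \<open>Mixed norms\<close>

text \<open>Keeps membership in the space available, from which measurability of sections and
  pointwise sign conditions follow.\<close>

lemma AE_mono_on_space:
  "AE x in M. P x \<Longrightarrow> (\<And>x. x \<in> space M \<Longrightarrow> P x \<Longrightarrow> Q x) \<Longrightarrow> AE x in M. Q x"
  by (rule AE_mp) (auto intro: AE_I2)

text \<open>Swapping the coordinates puts the second variable outside, which is the order of
  integration in the mixed norms.\<close>

lemma (in pair_sigma_finite) AE_pair_snd:
  assumes "AE z in M1 \<Otimes>\<^sub>M M2. Q z"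
  shows "AE y in M2. AE x in M1. Q (x, y)"
proof -
  interpret Q: pair_sigma_finite M2 M1 ..
  have "AE z in M2 \<Otimes>\<^sub>M M1. Q (case z of (y, x) \<Rightarrow> (x, y))"
    using assms by (subst (asm) distr_pair_swap) (rule AE_distrD[OF measurable_pair_swap'])
  from Q.AE_pair[OF this] show ?thesis by simp
qed

text \<open>Takes values in [0, \<infinity>] instead of complex ones, so that it applies to
  integrals not yet known to be finite, such as those in Minkowski's inequality.\<close>

definition mixed_nn_norm ::
  "'a measure \<Rightarrow> 'b measure \<Rightarrow> real \<Rightarrow> real \<Rightarrow> ('a \<times> 'b \<Rightarrow> ennreal) \<Rightarrow> ennreal" where
  "mixed_nn_norm M N q1 q2 G =
     (\<integral>\<^sup>+y. (\<integral>\<^sup>+x. G (x, y) epowr q1 \<partial>M) epowr (q2 / q1) \<partial>N) epowr (1 / q2)"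

lemma mixed_norm_eq: "mixed_norm M N q1 q2 f = mixed_nn_norm M N q1 q2 (\<lambda>z. ennreal (cmod (f z)))"
  by (simp add: mixed_norm_def mixed_nn_norm_def)

lemma mixed_nn_norm_mono_AE:
  assumes "q1 > 0" "q2 > 0" "AE y in N. AE x in M. G (x, y) \<le> H (x, y)"
  shows "mixed_nn_norm M N q1 q2 G \<le> mixed_nn_norm M N q1 q2 H"
proof -
  have "AE y in N. (\<integral>\<^sup>+x. G (x, y) epowr q1 \<partial>M) epowr (q2 / q1)
               \<le> (\<integral>\<^sup>+x. H (x, y) epowr q1 \<partial>M) epowr (q2 / q1)"
    using assms(3)
  proof (rule AE_mono_on_space)
    fix y assume "AE x in M. G (x, y) \<le> H (x, y)"
    then have "AE x in M. G (x, y) epowr q1 \<le> H (x, y) epowr q1"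
      by (rule AE_mono_on_space) (use assms in \<open>auto intro!: epowr_mono\<close>)
    then show "(\<integral>\<^sup>+x. G (x, y) epowr q1 \<partial>M) epowr (q2 / q1)
             \<le> (\<integral>\<^sup>+x. H (x, y) epowr q1 \<partial>M) epowr (q2 / q1)"
      using assms by (intro epowr_mono nn_integral_mono_AE) auto
  qed
  then show ?thesis
    unfolding mixed_nn_norm_def using assms by (intro epowr_mono nn_integral_mono_AE) auto
qed

lemma mixed_nn_norm_cmult:
  assumes "sigma_finite_measure M" "q1 > 0" "q2 > 0"
    and [measurable]: "G \<in> borel_measurable (M \<Otimes>\<^sub>M N)"
  shows "mixed_nn_norm M N q1 q2 (\<lambda>z. c * G z) = c * mixed_nn_norm M N q1 q2 G"
proof -
  interpret sigma_finite_measure M by fact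
  have "(\<integral>\<^sup>+x. (c * G (x, y)) epowr q1 \<partial>M) = c epowr q1 * (\<integral>\<^sup>+x. G (x, y) epowr q1 \<partial>M)"
    if "y \<in> space N" for y
    using assms(2) that by (simp add: epowr_mult nn_integral_cmult)
  then have "(\<integral>\<^sup>+y. (\<integral>\<^sup>+x. (c * G (x, y)) epowr q1 \<partial>M) epowr (q2 / q1) \<partial>N)
    = (\<integral>\<^sup>+y. c epowr q2 * (\<integral>\<^sup>+x. G (x, y) epowr q1 \<partial>M) epowr (q2 / q1) \<partial>N)"
    using assms by (intro nn_integral_cong) (simp add: epowr_mult epowr_epowr)
  also have "\<dots> = c epowr q2 * (\<integral>\<^sup>+y. (\<integral>\<^sup>+x. G (x, y) epowr q1 \<partial>M) epowr (q2 / q1) \<partial>N)"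
    by (intro nn_integral_cmult) measurable
  finally show ?thesis
    using assms by (simp add: mixed_nn_norm_def epowr_mult epowr_epowr)
qed

text \<open>The ratio of the two exponents is unchanged and the outer root becomes
  \<open>r / q2\<close>. This converts an integral norm of exponent \<open>r\<close> inside a mixed
  norm into a plain integral, to which Minkowski's inequality applies.\<close>

lemma mixed_nn_norm_epowr:
  assumes "q1 > 0" "q2 > 0" "r > 0"
  shows "mixed_nn_norm M N (q1 / r) (q2 / r) (\<lambda>z. G z epowr r) = mixed_nn_norm M N q1 q2 G epowr r"
  using assms by (simp add: mixed_nn_norm_def epowr_epowr)

text \<open>Minkowski's inequality is used twice: in \<open>x\<close> for each fixed
  \<open>y\<close>, and then in \<open>y\<close> for the resulting norms as functions of
  \<open>y\<close> and \<open>w\<close>.\<close>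

lemma mixed_nn_norm_Minkowski:
  assumes "sigma_finite_measure M" "sigma_finite_measure N" "sigma_finite_measure W"
    and q: "q1 \<ge> 1" "q2 \<ge> 1"
    and [measurable]: "G \<in> borel_measurable ((M \<Otimes>\<^sub>M N) \<Otimes>\<^sub>M W)"
  shows "mixed_nn_norm M N q1 q2 (\<lambda>z. \<integral>\<^sup>+w. G (z, w) \<partial>W)
    \<le> (\<integral>\<^sup>+w. mixed_nn_norm M N q1 q2 (\<lambda>z. G (z, w)) \<partial>W)"
proof -
  interpret M: sigma_finite_measure M by fact
  interpret W: sigma_finite_measure W by fact
  \<comment> \<open>Splitting the exponent \<open>q2 / q1\<close> exhibits the mixed norm as an
    outer norm of inner norms, each in the form of the scalar inequality.\<close>
  have eq: "mixed_nn_norm M N q1 q2 H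
      = (\<integral>\<^sup>+y. ((\<integral>\<^sup>+x. H (x, y) epowr q1 \<partial>M) epowr (1 / q1)) epowr q2 \<partial>N) epowr (1 / q2)" for H
    using q by (simp add: mixed_nn_norm_def epowr_epowr)
  have "mixed_nn_norm M N q1 q2 (\<lambda>z. \<integral>\<^sup>+w. G (z, w) \<partial>W)
    \<le> (\<integral>\<^sup>+y. (\<integral>\<^sup>+w. (\<integral>\<^sup>+x. G ((x, y), w) epowr q1 \<partial>M) epowr (1 / q1) \<partial>W) epowr q2 \<partial>N) epowr (1 / q2)"
    unfolding eq using q
    by (intro epowr_mono nn_integral_mono nn_integral_Minkowski assms) auto
  also have "\<dots> \<le> (\<integral>\<^sup>+w. (\<integral>\<^sup>+y. ((\<integral>\<^sup>+x. G ((x, y), w) epowr q1 \<partial>M) epowr (1 / q1)) epowr q2 \<partial>N) epowr (1 / q2) \<partial>W)"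
    by (intro nn_integral_Minkowski assms) measurable
  finally show ?thesis unfolding eq .
qed

text \<open>A finite integral forces a finite integrand almost everywhere, first in \<open>y\<close>
  and then in \<open>x\<close>; the iterated statement is then passed to the product
  measure.\<close>

lemma mixed_nn_norm_finite_AE:
  assumes "sigma_finite_measure M" "sigma_finite_measure N" "q1 > 0" "q2 > 0"
    and [measurable]: "G \<in> borel_measurable (M \<Otimes>\<^sub>M N)"
    and fin: "mixed_nn_norm M N q1 q2 G \<noteq> \<infinity>"
  shows "AE z in M \<Otimes>\<^sub>M N. G z \<noteq> \<infinity>"
proof -
  interpret M: sigma_finite_measure M by fact
  interpret N: sigma_finite_measure N by fact
  interpret pair_sigma_finite M N ..
  have "AE y in N. (\<integral>\<^sup>+x. G (x, y) epowr q1 \<partial>M) epowr (q2 / q1) \<noteq> \<infinity>"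
    using fin assms(3,4) by (intro nn_integral_noteq_infinite) (auto simp: mixed_nn_norm_def)
  then have "AE y in N. AE x in M. G (x, y) \<noteq> \<infinity>"
  proof (rule AE_mono_on_space)
    fix y assume [measurable]: "y \<in> space N"
      and "(\<integral>\<^sup>+x. G (x, y) epowr q1 \<partial>M) epowr (q2 / q1) \<noteq> \<infinity>"
    then have "(\<integral>\<^sup>+x. G (x, y) epowr q1 \<partial>M) \<noteq> \<infinity>"
      using assms(3,4) by auto
    then have "AE x in M. G (x, y) epowr q1 \<noteq> \<infinity>"
      by (intro nn_integral_noteq_infinite) measurable
    then show "AE x in M. G (x, y) \<noteq> \<infinity>"
      using assms(3) by (simp add: epowr_eq_top_iff)
  qed
  then have "AE x in M. AE y in N. G (x, y) \<noteq> \<infinity>"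
    by (subst AE_commute) simp_all
  then show ?thesis
    by (intro AE_pair_measure) simp_all
qed

subsection \<open>Schur test\<close>

text \<open>The test with the powers of the kernels hidden in two factors: \<open>a\<close> is the
  one that \<open>A\<close> controls by \<open>h\<close>, and \<open>b * h\<close> is what
  \<open>B\<close> controls. The almost-everywhere conditions are nested in the order of the
  integrals.\<close>

lemma mixed_Schur_bound:
  fixes k a b :: "('x \<times> 'y) \<times> ('s \<times> 't) \<Rightarrow> ennreal"
  assumes "sigma_finite_measure M1" "sigma_finite_measure M2"
    and "sigma_finite_measure N1" "sigma_finite_measure N2"
    and [measurable]: "a \<in> borel_measurable ((N1 \<Otimes>\<^sub>M N2) \<Otimes>\<^sub>M (M1 \<Otimes>\<^sub>M M2))"
      "b \<in> borel_measurable ((N1 \<Otimes>\<^sub>M N2) \<Otimes>\<^sub>M (M1 \<Otimes>\<^sub>M M2))"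
      "h \<in> borel_measurable (N1 \<Otimes>\<^sub>M N2)" "F \<in> borel_measurable (M1 \<Otimes>\<^sub>M M2)"
    and p: "p > 1" "1 / p + 1 / p' = 1" and q: "p \<le> q1" "p \<le> q2"
    and k: "\<And>z w. z \<in> space (N1 \<Otimes>\<^sub>M N2) \<Longrightarrow> w \<in> space (M1 \<Otimes>\<^sub>M M2) \<Longrightarrow> k (z, w) \<le> a (z, w) * b (z, w)"
    and A: "AE y in N2. AE x in N1. AE t in M2.
        (\<integral>\<^sup>+s. a ((x, y), (s, t)) epowr p' \<partial>M1) epowr (1 / p') \<le> c * h (x, y)"
    and B: "AE t in M2. AE s in M1.
        mixed_nn_norm N1 N2 q1 q2 (\<lambda>z. b (z, (s, t)) * h z) \<le> d"
  shows "mixed_nn_norm N1 N2 q1 q2 (\<lambda>z. \<integral>\<^sup>+t. \<integral>\<^sup>+s. k (z, (s, t)) * F (s, t) \<partial>M1 \<partial>M2)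
    \<le> c * d * mixed_nn_norm M1 M2 p 1 F"
proof -
  interpret M1: sigma_finite_measure M1 by fact
  interpret M2: sigma_finite_measure M2 by fact
  interpret N1: sigma_finite_measure N1 by fact
  interpret N2: sigma_finite_measure N2 by fact
  \<comment> \<open>The integrand left once Hoelder's inequality has replaced \<open>a\<close> by
    \<open>h\<close>. Since \<open>h z\<close> does not depend on \<open>w\<close>, it can be put
    inside the norm \<open>V\<close> over \<open>s\<close>.\<close>
  define B' where "B' z w = b (z, w) * h z * F w" for z w
  have [measurable]: "(\<lambda>(z, w). B' z w) \<in> borel_measurable ((N1 \<Otimes>\<^sub>M N2) \<Otimes>\<^sub>M (M1 \<Otimes>\<^sub>M M2))"
    unfolding B'_def by measurable
  define V where "V z t = (\<integral>\<^sup>+s. B' z (s, t) epowr p \<partial>M1) epowr (1 / p)" for z t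
  have V_measurable [measurable]: "(\<lambda>(z, t). V z t) \<in> borel_measurable ((N1 \<Otimes>\<^sub>M N2) \<Otimes>\<^sub>M M2)"
    unfolding V_def by measurable
  have pointwise: "(\<integral>\<^sup>+t. \<integral>\<^sup>+s. k (z, (s, t)) * F (s, t) \<partial>M1 \<partial>M2) \<le> c * (\<integral>\<^sup>+t. V z t \<partial>M2)"
    if z: "z \<in> space (N1 \<Otimes>\<^sub>M N2)"
      and H: "AE t in M2. (\<integral>\<^sup>+s. a (z, (s, t)) epowr p' \<partial>M1) epowr (1 / p') \<le> c * h z" for z
  proof -
    have step: "(\<integral>\<^sup>+s. k (z, (s, t)) * F (s, t) \<partial>M1) \<le> c * V z t"
      if t: "t \<in> space M2" and le: "(\<integral>\<^sup>+s. a (z, (s, t)) epowr p' \<partial>M1) epowr (1 / p') \<le> c * h z" for t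
    proof -
      have "(\<integral>\<^sup>+s. k (z, (s, t)) * F (s, t) \<partial>M1)
          \<le> (\<integral>\<^sup>+s. (b (z, (s, t)) * F (s, t)) * a (z, (s, t)) \<partial>M1)"
        using z t k[OF z, of "(_, t)"]
        by (intro nn_integral_mono) (auto simp: space_pair_measure mult.commute mult.left_commute intro!: mult_left_mono)
      also have "\<dots> \<le> (\<integral>\<^sup>+s. (b (z, (s, t)) * F (s, t)) epowr p \<partial>M1) epowr (1 / p)
           * (\<integral>\<^sup>+s. a (z, (s, t)) epowr p' \<partial>M1) epowr (1 / p')"
        using z t by (intro nn_integral_Holder p) auto
      also have "\<dots> \<le> (\<integral>\<^sup>+s. (b (z, (s, t)) * F (s, t)) epowr p \<partial>M1) epowr (1 / p) * (c * h z)"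
        by (intro mult_left_mono le) auto
      also have "\<dots> = c * V z t"
      proof -
        have "(\<integral>\<^sup>+s. B' z (s, t) epowr p \<partial>M1) = (\<integral>\<^sup>+s. h z epowr p * (b (z, (s, t)) * F (s, t)) epowr p \<partial>M1)"
          using p by (intro nn_integral_cong) (simp add: B'_def epowr_mult ac_simps)
        also have "\<dots> = h z epowr p * (\<integral>\<^sup>+s. (b (z, (s, t)) * F (s, t)) epowr p \<partial>M1)"
          using z t by (intro nn_integral_cmult) auto
        finally show ?thesis
          using p by (simp add: V_def epowr_mult epowr_epowr ac_simps)
      qed
      finally show ?thesis .
    qed
    have "AE t in M2. (\<integral>\<^sup>+s. k (z, (s, t)) * F (s, t) \<partial>M1) \<le> c * V z t"
      by (rule AE_mono_on_space[OF H]) (rule step)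
    then have "(\<integral>\<^sup>+t. \<integral>\<^sup>+s. k (z, (s, t)) * F (s, t) \<partial>M1 \<partial>M2) \<le> (\<integral>\<^sup>+t. c * V z t \<partial>M2)"
      by (rule nn_integral_mono_AE)
    also have "\<dots> = c * (\<integral>\<^sup>+t. V z t \<partial>M2)"
      using z by (intro nn_integral_cmult) measurable
    finally show ?thesis .
  qed
  have V_norm: "mixed_nn_norm N1 N2 q1 q2 (\<lambda>z. V z t) \<le> d * (\<integral>\<^sup>+s. F (s, t) epowr p \<partial>M1) epowr (1 / p)"
    if t: "t \<in> space M2" and le: "AE s in M1. mixed_nn_norm N1 N2 q1 q2 (\<lambda>z. b (z, (s, t)) * h z) \<le> d" for t
  proof -
    \<comment> \<open>The \<open>p\<close>-th power turns the norm over \<open>s\<close> into an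
      integral, at the price of the exponents \<open>q1 / p\<close> and \<open>q2 / p\<close>; they
      are at least 1, as Minkowski's inequality demands.\<close>
    have "mixed_nn_norm N1 N2 q1 q2 (\<lambda>z. V z t) epowr p
      = mixed_nn_norm N1 N2 (q1 / p) (q2 / p) (\<lambda>z. \<integral>\<^sup>+s. B' z (s, t) epowr p \<partial>M1)"
      using p q by (simp add: V_def epowr_epowr flip: mixed_nn_norm_epowr)
    also have "\<dots> \<le> (\<integral>\<^sup>+s. mixed_nn_norm N1 N2 (q1 / p) (q2 / p) (\<lambda>z. B' z (s, t) epowr p) \<partial>M1)"
      using p q t mixed_nn_norm_Minkowski[OF assms(3,4,1), of "q1 / p" "q2 / p" "\<lambda>(z, s). B' z (s, t) epowr p"]
      by simp
    also have "\<dots> = (\<integral>\<^sup>+s. (F (s, t) * mixed_nn_norm N1 N2 q1 q2 (\<lambda>z. b (z, (s, t)) * h z)) epowr p \<partial>M1)"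
    proof (rule nn_integral_cong)
      fix s assume s: "s \<in> space M1"
      have "mixed_nn_norm N1 N2 (q1 / p) (q2 / p) (\<lambda>z. B' z (s, t) epowr p)
        = mixed_nn_norm N1 N2 q1 q2 (\<lambda>z. F (s, t) * (b (z, (s, t)) * h z)) epowr p"
        using p q by (simp add: B'_def mult.commute flip: mixed_nn_norm_epowr)
      also have "\<dots> = (F (s, t) * mixed_nn_norm N1 N2 q1 q2 (\<lambda>z. b (z, (s, t)) * h z)) epowr p"
        using p q s t by (simp add: mixed_nn_norm_cmult assms(3))
      finally show "mixed_nn_norm N1 N2 (q1 / p) (q2 / p) (\<lambda>z. B' z (s, t) epowr p)
        = (F (s, t) * mixed_nn_norm N1 N2 q1 q2 (\<lambda>z. b (z, (s, t)) * h z)) epowr p" .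
    qed
    also have "\<dots> \<le> (\<integral>\<^sup>+s. (F (s, t) * d) epowr p \<partial>M1)"
      by (rule nn_integral_mono_AE, rule AE_mono_on_space[OF le])
        (use p in \<open>auto intro!: epowr_mono mult_left_mono\<close>)
    also have "\<dots> = d epowr p * (\<integral>\<^sup>+s. F (s, t) epowr p \<partial>M1)"
      using p t by (simp add: epowr_mult nn_integral_cmult mult.commute)
    finally show ?thesis using p by (simp add: epowr_le_iff epowr_mult epowr_epowr)
  qed
  have "mixed_nn_norm N1 N2 q1 q2 (\<lambda>z. \<integral>\<^sup>+t. \<integral>\<^sup>+s. k (z, (s, t)) * F (s, t) \<partial>M1 \<partial>M2)
    \<le> mixed_nn_norm N1 N2 q1 q2 (\<lambda>z. c * (\<integral>\<^sup>+t. V z t \<partial>M2))"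
  proof (rule mixed_nn_norm_mono_AE)
    show "AE y in N2. AE x in N1. (\<integral>\<^sup>+t. \<integral>\<^sup>+s. k ((x, y), (s, t)) * F (s, t) \<partial>M1 \<partial>M2)
         \<le> c * (\<integral>\<^sup>+t. V (x, y) t \<partial>M2)"
      using A
    proof (rule AE_mono_on_space)
      fix y
      assume y: "y \<in> space N2" and H: "AE x in N1. AE t in M2.
        (\<integral>\<^sup>+s. a ((x, y), (s, t)) epowr p' \<partial>M1) epowr (1 / p') \<le> c * h (x, y)"
      show "AE x in N1. (\<integral>\<^sup>+t. \<integral>\<^sup>+s. k ((x, y), (s, t)) * F (s, t) \<partial>M1 \<partial>M2)
         \<le> c * (\<integral>\<^sup>+t. V (x, y) t \<partial>M2)"
        by (rule AE_mono_on_space[OF H], rule pointwise) (use y in \<open>auto simp: space_pair_measure\<close>)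
    qed
  qed (use p q in auto)
  also have "\<dots> = c * mixed_nn_norm N1 N2 q1 q2 (\<lambda>z. \<integral>\<^sup>+t. V z t \<partial>M2)"
    using p q by (intro mixed_nn_norm_cmult assms) auto
  also have "\<dots> \<le> c * (\<integral>\<^sup>+t. mixed_nn_norm N1 N2 q1 q2 (\<lambda>z. V z t) \<partial>M2)"
    using p q mixed_nn_norm_Minkowski[OF assms(3,4,2), of q1 q2 "\<lambda>(z, t). V z t"]
    by (intro mult_left_mono) simp_all
  also have "\<dots> \<le> c * (\<integral>\<^sup>+t. d * (\<integral>\<^sup>+s. F (s, t) epowr p \<partial>M1) epowr (1 / p) \<partial>M2)"
    by (intro mult_left_mono nn_integral_mono_AE, rule AE_mono_on_space[OF B]) (simp_all add: V_norm)
  \<comment> \<open>With outer exponent 1, the mixed norm of \<open>F\<close> is exactly the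
    integral over \<open>t\<close> of its norms in \<open>s\<close>.\<close>
  also have "\<dots> = c * d * mixed_nn_norm M1 M2 p 1 F"
    by (simp add: nn_integral_cmult mixed_nn_norm_def mult.assoc)
  finally show ?thesis .
qed

text \<open>If \<open>g\<close> is not integrable, the Bochner integral is 0 and the bound is
  trivial.\<close>

lemma norm_integral_le_nn_integral:
  fixes g :: "_ \<Rightarrow> 'b::{banach, second_countable_topology}"
  shows "ennreal (norm (integral\<^sup>L M g)) \<le> (\<integral>\<^sup>+x. ennreal (norm (g x)) \<partial>M)"
  by (cases "integrable M g") (simp_all add: integral_norm_bound_ennreal not_integrable_integral_eq)

theorem proposition3p4:
  fixes X \<mu>1 \<mu>2 \<nu>1 \<nu>2 :: "'a measure"
    and K1 K2 h1 h2 :: "'a \<times> 'a \<Rightarrow> real"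
    and p1 p1' q1 q2 \<gamma>1 \<gamma>2 \<delta>1 \<delta>2 C1 C2 :: real
  assumes "sigma_finite_measure \<mu>1" and "sigma_finite_measure \<mu>2"
    and "sigma_finite_measure \<nu>1" and "sigma_finite_measure \<nu>2"
    and "sets \<mu>1 = sets X" and "sets \<mu>2 = sets X" and "sets \<nu>1 = sets X" and "sets \<nu>2 = sets X"
    and "K1 \<in> borel_measurable (X \<Otimes>\<^sub>M X)" and "K2 \<in> borel_measurable (X \<Otimes>\<^sub>M X)"
    and "\<forall>z \<in> space X \<times> space X. K1 z \<ge> 0" and "\<forall>z \<in> space X \<times> space X. K2 z \<ge> 0"
    and "1 < p1" and "1 / p1 + 1 / p1' = 1"
    and "1 < q1" and "1 < q2" and "p1 \<le> min q1 q2"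
    and "\<gamma>1 + \<delta>1 = 1" and "\<gamma>2 + \<delta>2 = 1"
    and "h1 \<in> borel_measurable (X \<Otimes>\<^sub>M X)" and "h2 \<in> borel_measurable (X \<Otimes>\<^sub>M X)"
    and "\<forall>z \<in> space X \<times> space X. h1 z > 0" and "\<forall>z \<in> space X \<times> space X. h2 z > 0"
    and "C1 > 0" and "C2 > 0"
    and "AE (x, y) in \<nu>1 \<Otimes>\<^sub>M \<nu>2.
           esssup \<mu>2 (\<lambda>t. \<integral>\<^sup>+ s. ennreal (K1 (x, s)) epowr (\<gamma>1 * p1') *
                              ennreal (K2 (y, t)) epowr (\<gamma>2 * p1') *
                              ennreal (h1 (s, t)) epowr p1' \<partial>\<mu>1)
           \<le> ennreal C1 * ennreal (h2 (x, y)) epowr p1'"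
    and "AE (s, t) in \<mu>1 \<Otimes>\<^sub>M \<mu>2.
           (\<integral>\<^sup>+ y. (\<integral>\<^sup>+ x. ennreal (K1 (x, s)) epowr (\<delta>1 * q1) *
                          ennreal (K2 (y, t)) epowr (\<delta>2 * q1) *
                          ennreal (h2 (x, y)) epowr q1 \<partial>\<nu>1) epowr (q2 / q1) \<partial>\<nu>2)
           \<le> ennreal C2 * ennreal (h1 (s, t)) epowr q2"
  shows "(\<forall>f \<in> mixed_Lp \<mu>1 \<mu>2 p1 1. kernel_op_defined \<mu>1 \<mu>2 \<nu>1 \<nu>2 K1 K2 f) \<and>
         mixed_bounded_op \<mu>1 \<mu>2 p1 1 \<nu>1 \<nu>2 q1 q2 (kernel_op \<mu>1 \<mu>2 K1 K2) \<and>
         mixed_op_norm \<mu>1 \<mu>2 p1 1 \<nu>1 \<nu>2 q1 q2 (kernel_op \<mu>1 \<mu>2 K1 K2)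
           \<le> ennreal (C1 powr (1 / p1') * C2 powr (1 / q2))"
proof -
  note sets = assms(5-8)
  note space = sets[THEN sets_eq_imp_space_eq]
  interpret \<mu>1: sigma_finite_measure \<mu>1 by fact
  interpret \<mu>2: sigma_finite_measure \<mu>2 by fact
  interpret \<nu>1: sigma_finite_measure \<nu>1 by fact
  interpret \<nu>2: sigma_finite_measure \<nu>2 by fact
  interpret \<mu>: pair_sigma_finite \<mu>1 \<mu>2 ..
  interpret \<nu>: pair_sigma_finite \<nu>1 \<nu>2 ..
  have p': "p1' > 1" using assms(13,14) by (rule conjugate_exponent_gt_1)
  have pq: "p1 > 1" "q1 > 1" "q2 > 1" "p1 \<le> q1" "p1 \<le> q2" using assms by auto
  have meas: "u \<in> borel_measurable (X \<Otimes>\<^sub>M X) \<Longrightarrow> sets M = sets X \<Longrightarrow> sets N = sets X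
      \<Longrightarrow> u \<in> borel_measurable (M \<Otimes>\<^sub>M N)" for u :: "'a \<times> 'a \<Rightarrow> real" and M N
    using measurable_cong_sets[OF sets_pair_measure_cong refl] by blast
  have [measurable]: "K1 \<in> borel_measurable (\<nu>1 \<Otimes>\<^sub>M \<mu>1)" "K2 \<in> borel_measurable (\<nu>2 \<Otimes>\<^sub>M \<mu>2)"
    "h1 \<in> borel_measurable (\<mu>1 \<Otimes>\<^sub>M \<mu>2)" "h2 \<in> borel_measurable (\<nu>1 \<Otimes>\<^sub>M \<nu>2)"
    by (rule meas[OF assms(9,7,5)] meas[OF assms(10,8,6)] meas[OF assms(20,5,6)] meas[OF assms(21,7,8)])+

  \<comment> \<open>Kernel factors and the two hypotheses in mixed-norm form\<close>
  define k where "k = (\<lambda>((x, y), (s, t)). ennreal (K1 (x, s) * K2 (y, t)))"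
  define a where "a = (\<lambda>((x, y), (s, t)).
    ennreal (K1 (x, s)) epowr \<gamma>1 * ennreal (K2 (y, t)) epowr \<gamma>2 * ennreal (h1 (s, t)))"
  define b where "b = (\<lambda>((x, y), (s, t)).
    ennreal (K1 (x, s)) epowr \<delta>1 * ennreal (K2 (y, t)) epowr \<delta>2 * ennreal (inverse (h1 (s, t))))"
  have [measurable]: "k \<in> borel_measurable ((\<nu>1 \<Otimes>\<^sub>M \<nu>2) \<Otimes>\<^sub>M (\<mu>1 \<Otimes>\<^sub>M \<mu>2))"
    "a \<in> borel_measurable ((\<nu>1 \<Otimes>\<^sub>M \<nu>2) \<Otimes>\<^sub>M (\<mu>1 \<Otimes>\<^sub>M \<mu>2))"
    "b \<in> borel_measurable ((\<nu>1 \<Otimes>\<^sub>M \<nu>2) \<Otimes>\<^sub>M (\<mu>1 \<Otimes>\<^sub>M \<mu>2))"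
    unfolding k_def a_def b_def case_prod_unfold by measurable
  define c where "c = ennreal C1 epowr (1 / p1')"
  define d where "d = ennreal C2 epowr (1 / q2)"
  have cd: "c * d = ennreal (C1 powr (1 / p1') * C2 powr (1 / q2))"
    using assms(24,25) by (simp add: c_def d_def epowr_ennreal_pos ennreal_mult)
  have k_le: "k (z, w) \<le> a (z, w) * b (z, w)"
    if "z \<in> space (\<nu>1 \<Otimes>\<^sub>M \<nu>2)" "w \<in> space (\<mu>1 \<Otimes>\<^sub>M \<mu>2)" for z w
    using that assms(11,12,22) unfolding k_def a_def b_def
    by (auto simp: space_pair_measure space intro!: ennreal_le_epowr_split assms(18,19))
  \<comment> \<open>The first hypothesis after taking the root of order \<open>p1'\<close>; the
    essential supremum becomes a bound for almost every \<open>t\<close>.\<close>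
  have A: "AE y in \<nu>2. AE x in \<nu>1. AE t in \<mu>2.
      (\<integral>\<^sup>+s. a ((x, y), (s, t)) epowr p1' \<partial>\<mu>1) epowr (1 / p1') \<le> c * ennreal (h2 (x, y))"
    using \<nu>.AE_pair_snd[OF assms(26)]
  proof (rule AE_mono_on_space, elim AE_mono_on_space)
    fix x y
    have eq: "a ((x, y), (s, t)) epowr p1' = ennreal (K1 (x, s)) epowr (\<gamma>1 * p1') *
        ennreal (K2 (y, t)) epowr (\<gamma>2 * p1') * ennreal (h1 (s, t)) epowr p1'" for s t
      using p' by (simp add: a_def epowr_mult epowr_epowr)
    let ?e = "esssup \<mu>2 (\<lambda>t. \<integral>\<^sup>+s. a ((x, y), (s, t)) epowr p1' \<partial>\<mu>1)"
    assume "case (x, y) of (x, y) \<Rightarrow> esssup \<mu>2 (\<lambda>t. \<integral>\<^sup>+ s. ennreal (K1 (x, s)) epowr (\<gamma>1 * p1') *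
        ennreal (K2 (y, t)) epowr (\<gamma>2 * p1') * ennreal (h1 (s, t)) epowr p1' \<partial>\<mu>1)
      \<le> ennreal C1 * ennreal (h2 (x, y)) epowr p1'"
    then have "?e \<le> ennreal C1 * ennreal (h2 (x, y)) epowr p1'"
      by (simp add: eq)
    then have "?e epowr (1 / p1') \<le> c * ennreal (h2 (x, y))"
      using p' epowr_mono[of "1 / p1'" ?e "ennreal C1 * ennreal (h2 (x, y)) epowr p1'"]
      by (simp add: c_def epowr_mult epowr_epowr)
    moreover have "AE t in \<mu>2. (\<integral>\<^sup>+s. a ((x, y), (s, t)) epowr p1' \<partial>\<mu>1) \<le> ?e"
      by (rule esssup_AE)
    ultimately show "AE t in \<mu>2. (\<integral>\<^sup>+s. a ((x, y), (s, t)) epowr p1' \<partial>\<mu>1) epowr (1 / p1')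
        \<le> c * ennreal (h2 (x, y))"
      using p' by (auto elim!: eventually_mono order_trans[rotated] intro!: epowr_mono)
  qed
  \<comment> \<open>The root of order \<open>q2\<close> of the second hypothesis bounds the mixed
    norm of \<open>g\<close> below by \<open>d\<close> times \<open>h1 (s, t)\<close>. The factor
    \<open>inverse (h1 (s, t))\<close> in \<open>b\<close> is constant in \<open>z\<close> and
    cancels this.\<close>
  have B: "AE t in \<mu>2. AE s in \<mu>1.
      mixed_nn_norm \<nu>1 \<nu>2 q1 q2 (\<lambda>z. b (z, (s, t)) * ennreal (h2 z)) \<le> d"
    using \<mu>.AE_pair_snd[OF assms(27)]
  proof (rule AE_mono_on_space, elim AE_mono_on_space)
    fix s t assume st: "s \<in> space \<mu>1" "t \<in> space \<mu>2"
    define g where "g = (\<lambda>(x, y).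
      ennreal (K1 (x, s)) epowr \<delta>1 * ennreal (K2 (y, t)) epowr \<delta>2 * ennreal (h2 (x, y)))"
    have [measurable]: "g \<in> borel_measurable (\<nu>1 \<Otimes>\<^sub>M \<nu>2)"
      unfolding g_def using st by measurable
    have h: "h1 (s, t) > 0" using st assms(22) by (auto simp: space)
    assume "case (s, t) of (s, t) \<Rightarrow> (\<integral>\<^sup>+ y. (\<integral>\<^sup>+ x. ennreal (K1 (x, s)) epowr (\<delta>1 * q1) *
        ennreal (K2 (y, t)) epowr (\<delta>2 * q1) * ennreal (h2 (x, y)) epowr q1 \<partial>\<nu>1) epowr (q2 / q1) \<partial>\<nu>2)
      \<le> ennreal C2 * ennreal (h1 (s, t)) epowr q2"
    then have "mixed_nn_norm \<nu>1 \<nu>2 q1 q2 g \<le> (ennreal C2 * ennreal (h1 (s, t)) epowr q2) epowr (1 / q2)"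
      unfolding mixed_nn_norm_def using pq
      by (intro epowr_mono) (simp_all add: g_def epowr_mult epowr_epowr)
    also have "\<dots> = d * ennreal (h1 (s, t))"
      using pq by (simp add: d_def epowr_mult epowr_epowr)
    finally have le: "mixed_nn_norm \<nu>1 \<nu>2 q1 q2 g \<le> d * ennreal (h1 (s, t))" .
    have "mixed_nn_norm \<nu>1 \<nu>2 q1 q2 (\<lambda>z. b (z, (s, t)) * ennreal (h2 z))
      = mixed_nn_norm \<nu>1 \<nu>2 q1 q2 (\<lambda>z. ennreal (inverse (h1 (s, t))) * g z)"
      by (rule arg_cong[where f = "mixed_nn_norm \<nu>1 \<nu>2 q1 q2"])
         (auto simp: b_def g_def fun_eq_iff ac_simps)
    also have "\<dots> = ennreal (inverse (h1 (s, t))) * mixed_nn_norm \<nu>1 \<nu>2 q1 q2 g"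
      using pq by (intro mixed_nn_norm_cmult assms) auto
    also have "\<dots> \<le> ennreal (inverse (h1 (s, t))) * (d * ennreal (h1 (s, t)))"
      by (intro mult_left_mono le) auto
    also have "\<dots> = d * ennreal (inverse (h1 (s, t)) * h1 (s, t))"
      using h by (simp only: ennreal_mult' ac_simps)
    also have "\<dots> = d"
      using h by simp
    finally show "mixed_nn_norm \<nu>1 \<nu>2 q1 q2 (\<lambda>z. b (z, (s, t)) * ennreal (h2 z)) \<le> d" .
  qed

  \<comment> \<open>Absolute convergence, linearity and norm of the operator\<close>
  let ?T = "kernel_op \<mu>1 \<mu>2 K1 K2"
  let ?Lp = "mixed_Lp \<mu>1 \<mu>2 p1 1"
  \<comment> \<open>The integral of the absolute values. Its norm bound gives both convergence
    almost everywhere and the bound for \<open>?T f\<close>.\<close>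
  define S where "S f z = (\<integral>\<^sup>+t. \<integral>\<^sup>+s. k (z, (s, t)) * ennreal (cmod (f (s, t))) \<partial>\<mu>1 \<partial>\<mu>2)"
    for f :: "'a \<times> 'a \<Rightarrow> complex" and z
  have Lp_meas: "f \<in> borel_measurable (\<mu>1 \<Otimes>\<^sub>M \<mu>2)" if "f \<in> ?Lp" for f
    using that by (simp add: mixed_Lp_def)
  have S_bound: "mixed_nn_norm \<nu>1 \<nu>2 q1 q2 (S f) \<le> c * d * mixed_norm \<mu>1 \<mu>2 p1 1 f"
    if "f \<in> ?Lp" for f
    unfolding S_def mixed_norm_eq using Lp_meas[OF that] pq assms(14)
    by (intro mixed_Schur_bound[OF assms(1-4), where h = "\<lambda>z. ennreal (h2 z)" and a = a and b = b
          and p' = p1' and F = "\<lambda>w. ennreal (cmod (f w))"] k_le A B) auto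
  have S_finite: "AE z in \<nu>1 \<Otimes>\<^sub>M \<nu>2. S f z \<noteq> \<infinity>" if f: "f \<in> ?Lp" for f
  proof (rule mixed_nn_norm_finite_AE)
    have [measurable]: "f \<in> borel_measurable (\<mu>1 \<Otimes>\<^sub>M \<mu>2)" by (rule Lp_meas[OF f])
    show "S f \<in> borel_measurable (\<nu>1 \<Otimes>\<^sub>M \<nu>2)"
      unfolding S_def by measurable
    have "c * d * mixed_norm \<mu>1 \<mu>2 p1 1 f < \<infinity>"
      using f by (auto simp: cd mixed_Lp_def ennreal_mult_less_top)
    then show "mixed_nn_norm \<nu>1 \<nu>2 q1 q2 (S f) \<noteq> \<infinity>"
      using S_bound[OF f] by auto
  qed (use pq assms in auto)
  have integrand_norm: "ennreal (cmod (complex_of_real (K1 (x, s) * K2 (y, t)) * f (s, t)))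
      = k ((x, y), (s, t)) * ennreal (cmod (f (s, t)))"
    if "x \<in> space \<nu>1" "y \<in> space \<nu>2" "s \<in> space \<mu>1" "t \<in> space \<mu>2" for f x y s t
    using that assms(11,12) by (simp add: k_def norm_mult space flip: ennreal_mult)
  have T_meas: "?T f \<in> borel_measurable (\<nu>1 \<Otimes>\<^sub>M \<nu>2)"
    if [measurable]: "f \<in> borel_measurable (\<mu>1 \<Otimes>\<^sub>M \<mu>2)" for f
    unfolding kernel_op_def by measurable
  \<comment> \<open>This holds at every point, also where the integrals do not converge, because the
    Bochner integral is 0 there.\<close>
  have T_le: "ennreal (cmod (?T f (x, y))) \<le> S f (x, y)"
    if "x \<in> space \<nu>1" "y \<in> space \<nu>2" for f x y
  proof -
    let ?g = "\<lambda>s t. complex_of_real (K1 (x, s) * K2 (y, t)) * f (s, t)"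
    have "ennreal (cmod (?T f (x, y))) \<le> (\<integral>\<^sup>+t. ennreal (cmod (LINT s|\<mu>1. ?g s t)) \<partial>\<mu>2)"
      by (simp add: kernel_op_def norm_integral_le_nn_integral del: of_real_mult)
    also have "\<dots> \<le> (\<integral>\<^sup>+t. \<integral>\<^sup>+s. ennreal (cmod (?g s t)) \<partial>\<mu>1 \<partial>\<mu>2)"
      by (intro nn_integral_mono norm_integral_le_nn_integral)
    also have "\<dots> = S f (x, y)"
      unfolding S_def using that by (intro nn_integral_cong integrand_norm)
    finally show ?thesis .
  qed
  have T_bound: "mixed_norm \<nu>1 \<nu>2 q1 q2 (?T f) \<le> c * d * mixed_norm \<mu>1 \<mu>2 p1 1 f"
    if "f \<in> ?Lp" for f
  proof -
    have "mixed_norm \<nu>1 \<nu>2 q1 q2 (?T f) \<le> mixed_nn_norm \<nu>1 \<nu>2 q1 q2 (S f)"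
      unfolding mixed_norm_eq using pq
      by (intro mixed_nn_norm_mono_AE) (auto intro!: AE_I2 T_le)
    then show ?thesis using S_bound[OF that] by (rule order_trans)
  qed
  have defined: "kernel_op_defined \<mu>1 \<mu>2 \<nu>1 \<nu>2 K1 K2 f" if f: "f \<in> ?Lp" for f
    unfolding kernel_op_defined_def using S_finite[OF f]
  proof (rule AE_mono_on_space, safe)
    fix x y assume z: "(x, y) \<in> space (\<nu>1 \<Otimes>\<^sub>M \<nu>2)" and fin: "S f (x, y) \<noteq> \<infinity>"
    have [measurable]: "x \<in> space \<nu>1" "y \<in> space \<nu>2" using z by (auto simp: space_pair_measure)
    have [measurable]: "f \<in> borel_measurable (\<mu>1 \<Otimes>\<^sub>M \<mu>2)" by (rule Lp_meas[OF f])
    let ?g = "\<lambda>(s, t). complex_of_real (K1 (x, s) * K2 (y, t)) * f (s, t)"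
    have [measurable]: "?g \<in> borel_measurable (\<mu>1 \<Otimes>\<^sub>M \<mu>2)" by measurable
    \<comment> \<open>Tonelli's theorem: finiteness of the iterated integral
      \<open>S f (x, y)\<close> is integrability on the product.\<close>
    have "(\<integral>\<^sup>+w. ennreal (cmod (?g w)) \<partial>(\<mu>1 \<Otimes>\<^sub>M \<mu>2)) = (\<integral>\<^sup>+t. \<integral>\<^sup>+s. ennreal (cmod (?g (s, t))) \<partial>\<mu>1 \<partial>\<mu>2)"
      by (rule \<mu>.nn_integral_snd[symmetric]) measurable
    also have "\<dots> = S f (x, y)"
      unfolding S_def prod.case by (intro nn_integral_cong integrand_norm) measurable
    finally show "integrable (\<mu>1 \<Otimes>\<^sub>M \<mu>2) ?g"
      using fin by (intro integrableI_bounded) (auto simp: less_top)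
  qed
  \<comment> \<open>Where both kernel integrals converge absolutely, Fubini's theorem writes
    \<open>?T\<close> as one integral over the product, where linearity holds; inner integrals that
    fail to exist for exceptional \<open>t\<close> then do no harm.\<close>
  have linear: "AE z in \<nu>1 \<Otimes>\<^sub>M \<nu>2. ?T (\<lambda>w. \<alpha> * f w + \<beta> * g w) z = \<alpha> * ?T f z + \<beta> * ?T g z"
    if "f \<in> ?Lp" "g \<in> ?Lp" for f g \<alpha> \<beta>
    using defined[OF that(1), unfolded kernel_op_defined_def] defined[OF that(2), unfolded kernel_op_defined_def]
  proof eventually_elim
    case (elim z)
    obtain x y where z: "z = (x, y)" by (cases z)
    let ?g = "\<lambda>f (s, t). complex_of_real (K1 (x, s) * K2 (y, t)) * f (s, t)"
    have int: "integrable (\<mu>1 \<Otimes>\<^sub>M \<mu>2) (?g f)" "integrable (\<mu>1 \<Otimes>\<^sub>M \<mu>2) (?g g)"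
      using elim by (simp_all add: z)
    have eq: "?g (\<lambda>w. \<alpha> * f w + \<beta> * g w) = (\<lambda>w. \<alpha> * ?g f w + \<beta> * ?g g w)"
      by (auto simp: fun_eq_iff algebra_simps)
    have T_eq: "?T u z = integral\<^sup>L (\<mu>1 \<Otimes>\<^sub>M \<mu>2) (?g u)" if "integrable (\<mu>1 \<Otimes>\<^sub>M \<mu>2) (?g u)" for u
      using \<mu>.integral_snd[OF that] by (simp add: kernel_op_def z)
    have "integrable (\<mu>1 \<Otimes>\<^sub>M \<mu>2) (?g (\<lambda>w. \<alpha> * f w + \<beta> * g w))"
      unfolding eq by (intro Bochner_Integration.integrable_add integrable_mult_right int)
    then have "?T (\<lambda>w. \<alpha> * f w + \<beta> * g w) z = (LINT w|(\<mu>1 \<Otimes>\<^sub>M \<mu>2). \<alpha> * ?g f w + \<beta> * ?g g w)"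
      by (simp only: T_eq eq)
    also have "\<dots> = (LINT w|(\<mu>1 \<Otimes>\<^sub>M \<mu>2). \<alpha> * ?g f w) + (LINT w|(\<mu>1 \<Otimes>\<^sub>M \<mu>2). \<beta> * ?g g w)"
      by (intro Bochner_Integration.integral_add integrable_mult_right int)
    also have "\<dots> = \<alpha> * ?T f z + \<beta> * ?T g z"
      by (simp only: integral_mult_right_zero T_eq[OF int(1)] T_eq[OF int(2)])
    finally show ?case .
  qed
  have T_Lp: "?T f \<in> mixed_Lp \<nu>1 \<nu>2 q1 q2" if f: "f \<in> ?Lp" for f
  proof -
    have "c * d * mixed_norm \<mu>1 \<mu>2 p1 1 f < \<infinity>"
      using f by (auto simp: cd mixed_Lp_def ennreal_mult_less_top)
    then show ?thesis
      using T_bound[OF f] T_meas[OF Lp_meas[OF f]] by (auto simp: mixed_Lp_def)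
  qed
  have "mixed_op_norm \<mu>1 \<mu>2 p1 1 \<nu>1 \<nu>2 q1 q2 ?T \<le> c * d"
    unfolding mixed_op_norm_def
  proof (rule SUP_least, clarify)
    fix f assume f: "f \<in> ?Lp" "mixed_norm \<mu>1 \<mu>2 p1 1 f \<le> 1"
    have "mixed_norm \<nu>1 \<nu>2 q1 q2 (?T f) \<le> c * d * 1"
      using T_bound[OF f(1)] mult_left_mono[OF f(2), of "c * d"] by (auto intro: order_trans)
    then show "mixed_norm \<nu>1 \<nu>2 q1 q2 (?T f) \<le> c * d" by simp
  qed
  moreover have "mixed_bounded_op \<mu>1 \<mu>2 p1 1 \<nu>1 \<nu>2 q1 q2 ?T"
    \<comment> \<open>Rewriting with \<open>cd\<close> turns \<open>c * d\<close> into the image of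
      a real number, the witness for the bounding constant.\<close>
    unfolding mixed_bounded_op_def using T_Lp linear T_bound unfolding cd by blast
  ultimately show ?thesis
    using defined unfolding cd by blast
qed

end
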